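(* Let $n \geq 7$ and let $KG(n,3)$ be the Kneser graph whose vertices are the $3$-element subsets of $\{1,\dots,n\}$, two vertices being adjacent if and only if the corresponding subsets are disjoint. Then the super-connectivity $\kappa_1$ of $KG(n,3)$ is \[ \kappa_1=\begin{cases} 2\left(\binom{n-3}{3}-1\right) & \text{if } 7\le n\le 8,\\[4pt] 2\left(\binom{n-3}{3}-1\right)-\binom{n-6}{3} & \text{if } n\ge 9.\end{cases} \]
   Context: For a connected graph $G$, a super vertex cut is a set $S$ of vertices of $G$ such that $G-S$ is disconnected and no component of $G-S$ is an isolated vertex. The super-connectivity $\kappa_1(G)$ is the minimum size of a super vertex cut of $G$. *)

theory Defs
  imports "Graph_Theory.Digraph_Component" "HOL-Library.Extended_Nat"
begin

definition kneser_graph :: "nat \<Rightarrow> nat \<Rightarrow> nat set pair_pre_digraph" where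
  "kneser_graph n k =
     \<lparr> pverts = {A. A \<subseteq> {1..n} \<and> card A = k},
       parcs = {(A, B). A \<subseteq> {1..n} \<and> card A = k \<and> B \<subseteq> {1..n} \<and> card B = k \<and> A \<inter> B = {}} \<rparr>"

text \<open>
  For \<open>k = 0\<close> the only vertex, the empty set, carries a loop; otherwise this is a finite simple
  graph in the sense of the locale \<^locale>\<open>graph\<close> (a finite symmetric digraph without loops and
  parallel arcs).
\<close>

lemma graph_kneser_graph:
  assumes "k > 0"
  shows "graph (with_proj (kneser_graph n k))"
proof -
  have fin: "finite (pverts (kneser_graph n k))"
    by (rule finite_subset[of _ "Pow {1..n}"]) (auto simp: kneser_graph_def)
  have sub: "parcs (kneser_graph n k) \<subseteq> pverts (kneser_graph n k) \<times> pverts (kneser_graph n k)"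
    by (auto simp: kneser_graph_def)
  have "pair_graph (kneser_graph n k)"
  proof
    show "finite (parcs (kneser_graph n k))"
      using fin sub by (meson finite_SigmaI finite_subset)
    show "symmetric (with_proj (kneser_graph n k))"
      by (simp add: symmetric_def sym_def kneser_graph_def Int_commute)
  next
    fix e
    assume e: "e \<in> parcs (kneser_graph n k)"
    then show "fst e \<noteq> snd e"
      using assms by (cases e) (simp add: kneser_graph_def, metis Int_absorb card.empty less_irrefl)
  qed (use fin sub in auto)
  then show ?thesis
    by (rule pair_graph.pair_graphD_graph)
qed

text \<open>
  The notion is reserved for connected (finite simple) graphs.  In a symmetric digraph the strongly
  connected components \<^const>\<open>pre_digraph.sccs\<close> are the connected components.  The predicate
  \<^const>\<open>connected\<close> is false for the graph without vertices, so \<open>S \<noteq> verts G\<close> is required in order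
  that deleting all vertices does not count as disconnecting the graph.
\<close>

definition super_vertex_cut :: "('a, 'b) pre_digraph \<Rightarrow> 'a set \<Rightarrow> bool" where
  "super_vertex_cut G S \<longleftrightarrow>
     graph G \<and> connected G \<and> S \<subseteq> verts G \<and> S \<noteq> verts G \<and>
     \<not> connected (G \<restriction> (verts G - S)) \<and>
     (\<forall>C \<in> pre_digraph.sccs (G \<restriction> (verts G - S)). \<not> (\<exists>v. verts C = {v}))"

text \<open>
  The infimum is a minimum as soon as a super vertex cut exists, and \<open>\<infinity>\<close> otherwise; in particular
  a finite value asserts that a super vertex cut exists.
\<close>

definition super_connectivity :: "('a, 'b) pre_digraph \<Rightarrow> enat" where
  "super_connectivity G = (INF S \<in> {S. super_vertex_cut G S}. enat (card S))"

end

theory Submission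
  imports Defs
begin

text \<open>
  The neighbourhood of an edge is a super vertex cut of the claimed size.  Conversely let \<open>S\<close> be a
  super vertex cut.  Both sides \<open>X\<close>, \<open>Y\<close> of the graph without \<open>S\<close> contain an edge, say \<open>A - B\<close> and
  \<open>C - D\<close>, and every set in \<open>X\<close> meets every set in \<open>Y\<close>.  By the easy direction of Menger's theorem
  it suffices to attach to every neighbour \<open>v\<close> of the edge \<open>A - B\<close> a path from \<open>v\<close> to a
  neighbour of the edge \<open>C - D\<close> in such a way that these paths are pairwise disjoint, as \<open>S\<close> has to
  hit each of them.  A common neighbour of both edges is a path by itself, and the other
  neighbours need a path \<open>v - q\<close> or \<open>v - u - q\<close>.  Up to symmetry there are only three
  configurations of \<open>A\<close>, \<open>B\<close>, \<open>C\<close>, \<open>D\<close>, depending on how many of the third points of \<open>C\<close> and \<open>D\<close>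
  lie in \<open>A \<union> B\<close>, and suitable paths can be written down for each of them.
\<close>

section \<open>Disjoint path systems\<close>

definition triples :: "'a set \<Rightarrow> 'a set set" where
  "triples V = {v. v \<subseteq> V \<and> card v = 3}"

text \<open>
  Disjointness of the paths is encoded by a single function \<open>\<rho>\<close> that maps every inner vertex of a
  path to the start \<open>v\<close> of that path.
\<close>

definition route_end ::
    "'a set \<Rightarrow> 'a set \<Rightarrow> 'a set \<Rightarrow> 'a set \<Rightarrow> 'a set \<Rightarrow> ('a set \<Rightarrow> 'a set) \<Rightarrow> 'a set \<Rightarrow> 'a set \<Rightarrow> bool"
  where "route_end V A B C D \<rho> v q \<longleftrightarrow>
    q \<in> triples V \<and> (q \<inter> C = {} \<or> q \<inter> D = {}) \<and> q \<inter> A \<noteq> {} \<and> q \<inter> B \<noteq> {} \<and> \<rho> q = v"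

text \<open>A start is a neighbour of the edge \<open>A - B\<close>, whereas \<open>q\<close> and
  \<open>u\<close> meet both \<open>A\<close> and \<open>B\<close>. So inner vertices are never
  starts, and the equations for \<open>\<rho>\<close> keep the paths of different starts
  apart.\<close>

definition route ::
    "'a set \<Rightarrow> 'a set \<Rightarrow> 'a set \<Rightarrow> 'a set \<Rightarrow> 'a set \<Rightarrow> ('a set \<Rightarrow> 'a set) \<Rightarrow> 'a set \<Rightarrow> bool"
  where "route V A B C D \<rho> v \<longleftrightarrow>
    (\<exists>q. route_end V A B C D \<rho> v q \<and>
       (q \<inter> v = {} \<or>
        (\<exists>u \<in> triples V. u \<inter> A \<noteq> {} \<and> u \<inter> B \<noteq> {} \<and> u \<inter> q = {} \<and> u \<inter> v = {} \<and> \<rho> u = v)))"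

lemma route_direct:
  assumes "route_end V A B C D \<rho> v q" "q \<inter> v = {}"
  shows "route V A B C D \<rho> v"
  using assms unfolding route_def by blast

lemma route_via:
  assumes "route_end V A B C D \<rho> v q"
    and "u \<in> triples V" "u \<inter> A \<noteq> {}" "u \<inter> B \<noteq> {}" "u \<inter> q = {}" "u \<inter> v = {}" "\<rho> u = v"
  shows "route V A B C D \<rho> v"
  using assms unfolding route_def by blast

text \<open>Neighbours of \<open>A - B\<close> that miss \<open>C\<close> or \<open>D\<close> are
  left out, since they are paths by themselves.\<close>

definition routed :: "'a set \<Rightarrow> 'a set \<Rightarrow> 'a set \<Rightarrow> 'a set \<Rightarrow> 'a set \<Rightarrow> bool" where
  "routed V A B C D \<longleftrightarrow> (\<exists>\<rho>. \<forall>v \<in> triples V.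
     (v \<inter> A = {} \<or> v \<inter> B = {}) \<and> v \<noteq> A \<and> v \<noteq> B \<and> v \<inter> C \<noteq> {} \<and> v \<inter> D \<noteq> {} \<longrightarrow>
     route V A B C D \<rho> v)"

section \<open>Explicit triples and routes along a cyclic shift\<close>

lemma triples_third:
  assumes "v \<in> triples V" "a \<in> v" "b \<in> v" "a \<noteq> b"
  obtains r where "v = {a, b, r}" "r \<in> V" "r \<noteq> a" "r \<noteq> b"
proof -
  have "card (v - {a, b}) = 1"
    using assms by (simp add: triples_def card_Diff_subset)
  then obtain r where r: "v - {a, b} = {r}" by (auto simp: card_1_singleton_iff)
  then have "v = {a, b, r}" "r \<noteq> a" "r \<noteq> b" using assms(2,3) by auto
  moreover have "r \<in> V" using r assms(1) unfolding triples_def by blast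
  ultimately show thesis by (intro that)
qed

text \<open>A rewrite rule for explicit triples in increasing order: the order makes the points
  distinct, and \<open>Suc 0\<close> is the simplifier's form of \<open>1\<close>.\<close>

lemma triples_atLeastAtMost:
  "x < y \<Longrightarrow> y < z \<Longrightarrow> {x, y, z} \<in> triples {Suc 0..n} \<longleftrightarrow> 1 \<le> x \<and> z \<le> n"
  by (auto simp: triples_def)

text \<open>
  The sets \<open>{a, b, z}\<close> and \<open>{c, d, z'}\<close> with distinct \<open>a, b, c, d < k\<close> are adjacent unless \<open>z = z'\<close>, so a cyclic
  shift of \<open>{k..n}\<close> matches the sets of the first kind with those of the second kind, except when
  \<open>k = n\<close>.
\<close>

definition shift :: "nat \<Rightarrow> nat \<Rightarrow> nat \<Rightarrow> nat" where
  "shift k n z = (if z = n then k else Suc z)"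

lemma shift_preimage:
  assumes "k \<le> z" "z \<le> n"
  obtains z' where "k \<le> z'" "z' \<le> n" "shift k n z' = z" "z' = z \<Longrightarrow> z = k \<and> k = n"
proof (cases "z = k")
  case True
  show thesis by (rule that[of n]) (use True assms in \<open>auto simp: shift_def\<close>)
next
  case False
  show thesis by (rule that[of "z - 1"]) (use False assms in \<open>auto simp: shift_def\<close>)
qed

text \<open>\<open>f r\<close> is joined to \<open>g z\<close> for the preimage \<open>z\<close> of
  \<open>r\<close> under the shift. A fixed point occurs only for \<open>k = n\<close>; there
  \<open>u\<close> is inserted between \<open>f k\<close> and \<open>g k\<close>.\<close>

lemma route_shift_via:
  assumes r: "k \<le> r" "r \<le> n"
    and g: "\<And>z. k \<le> z \<Longrightarrow> z \<le> n \<Longrightarrow> route_end V A B C D \<rho> (f (shift k n z)) (g z)"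
    and disj: "\<And>y z. k \<le> y \<Longrightarrow> k \<le> z \<Longrightarrow> z \<noteq> y \<Longrightarrow> g z \<inter> f y = {}"
    and last: "k = n \<Longrightarrow> u \<in> triples V \<and> u \<inter> A \<noteq> {} \<and> u \<inter> B \<noteq> {} \<and> u \<inter> g k = {} \<and> u \<inter> f k = {} \<and> \<rho> u = f k"
  shows "route V A B C D \<rho> (f r)"
proof -
  obtain z where z: "k \<le> z" "z \<le> n" "shift k n z = r" and *: "z = r \<Longrightarrow> r = k \<and> k = n"
    using shift_preimage[OF r] by blast
  have "g z \<inter> f r = {} \<or>
      (\<exists>u \<in> triples V. u \<inter> A \<noteq> {} \<and> u \<inter> B \<noteq> {} \<and> u \<inter> g z = {} \<and> u \<inter> f r = {} \<and> \<rho> u = f r)"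
  proof (cases "z = r")
    case True
    with * last show ?thesis by blast
  qed (use disj z r in blast)
  then show ?thesis
    unfolding route_def using g[OF z(1,2)] z(3) by blast
qed

text \<open>
  Here \<open>f k\<close> and \<open>g k\<close> are exceptional sets.  They keep the shift free of fixed points even if
  there is only one ordinary index, and their adjacency settles the case of none.
\<close>

lemma route_shift_star:
  assumes r: "k \<le> r" "r \<le> n"
    and g: "\<And>z. k < z \<Longrightarrow> z \<le> n \<Longrightarrow> route_end V A B C D \<rho> (f (shift k n z)) (g z)"
      "route_end V A B C D \<rho> (f (shift k n k)) (g k)"
    and disj: "\<And>y z. k < y \<Longrightarrow> k < z \<Longrightarrow> z \<noteq> y \<Longrightarrow> g z \<inter> f y = {}"
      "g k \<inter> f k = {}" "\<And>z. k < z \<Longrightarrow> g k \<inter> f z = {}" "\<And>z. k < z \<Longrightarrow> g z \<inter> f k = {}"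
  shows "route V A B C D \<rho> (f r)"
proof -
  obtain z where z: "k \<le> z" "z \<le> n" "shift k n z = r" and *: "z = r \<Longrightarrow> r = k \<and> k = n"
    using shift_preimage[OF r] by blast
  have "g z \<inter> f r = {}"
  proof (cases "z = k \<or> r = k")
    case True
    with disj(2-4) z(1) r(1) show ?thesis by (metis le_neq_implies_less)
  next
    case False
    with * z(1) r(1) have "k < z" "k < r" "z \<noteq> r" by auto
    with disj(1) show ?thesis by blast
  qed
  moreover have "route_end V A B C D \<rho> (f r) (g z)"
    using g(1)[of z] g(2) z by (cases "z = k") simp_all
  ultimately show ?thesis
    unfolding route_def by blast
qed

section \<open>The three configurations\<close>

text \<open>
  The values of \<open>\<rho>\<close> in this section were found by a computer search.
\<close>

lemma routed_147_258:
  assumes n: "8 \<le> (n::nat)"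
  shows "routed {1..n} {1,2,3} {4,5,6} {1,4,7} {2,5,8}"
proof -
  \<comment> \<open>The functions \<open>f\<close> list starts and the functions \<open>g\<close>
    the ends assigned to them, up to the shift. The digits in a name are the two fixed points of the
    ordinary members; index 8 holds the exceptional pair of \<open>route_shift_star\<close>.\<close>
  define f12 where "f12 z = (if z = 8 then {2,7,8} else {1,2,z})" for z :: nat
  define g35 where "g35 z = (if z = 8 then {3,5,6} else {3,5,z})" for z :: nat
  define f45 where "f45 z = (if z = 8 then {4,5,8} else {4,5,z})" for z :: nat
  define g26 where "g26 z = (if z = 8 then {1,6,7} else {2,6,z})" for z :: nat
  define f48 where "f48 z = (if z = 8 then {1,3,8} else {4,8,z})" for z :: nat
  define g25 where "g25 z = (if z = 8 then {2,5,6} else {2,5,z})" for z :: nat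
  define f78 where "f78 z = (if z = 8 then {5,7,8} else {7,8,z})" for z :: nat
  define g14 where "g14 z = (if z = 8 then {3,4,6} else {1,4,z})" for z :: nat
  define f18 where "f18 z = (if z = 8 then {1,2,8} else {1,8,z})" for z :: nat
  define g36 where "g36 z = (if z = 8 then {3,4,7} else {3,6,z})" for z :: nat
  \<comment> \<open>Patterns of three points precede those of two, because the latter also match
    some of the special sets. For an ordinary end, \<open>Max q\<close> recovers the variable point,
    which is at least 9. The final \<open>{}\<close> is an arbitrary default.\<close>
  define \<rho> where "\<rho> q =
    (if {3,5,8} \<subseteq> q then {1,2,7}
     else if {2,3,5} \<subseteq> q then {4,6,8}
     else if {1,4,6} \<subseteq> q then {2,3,7}
     else if {1,3,6} \<subseteq> q then {4,7,8}
     else if {2,3,6} \<subseteq> q then {1,7,8}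
     else if {2,6,8} \<subseteq> q then {4,5,7}
     else if {1,3,4} \<subseteq> q then {6,7,8}
     else if {3,6,8} \<subseteq> q then {3,7,8}
     else if {1,2,4} \<subseteq> q then {3,7,8}
     else if {3,6,7} \<subseteq> q then {5,6,7}
     else if {2,4,8} \<subseteq> q then {5,6,7}
     else if {3,5,6} \<subseteq> q then f12 (shift 8 n 8)
     else if {1,6,7} \<subseteq> q then f45 (shift 8 n 8)
     else if {2,5,6} \<subseteq> q then f48 (shift 8 n 8)
     else if {3,4,6} \<subseteq> q then f78 (shift 8 n 8)
     else if {3,4,7} \<subseteq> q then f18 (shift 8 n 8)
     else if {3,4,5} \<subseteq> q then {2,7,9}
     else if {1,6,8} \<subseteq> q then {5,7,9}
     else if {3,5} \<subseteq> q then f12 (shift 8 n (Max q))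
     else if {2,6} \<subseteq> q then f45 (shift 8 n (Max q))
     else if {2,5} \<subseteq> q then f48 (shift 8 n (Max q))
     else if {1,4} \<subseteq> q then f78 (shift 8 n (Max q))
     else if {3,6} \<subseteq> q then f18 (shift 8 n (Max q))
     else if {1,6} \<subseteq> q then {2,7,shift 9 n (Max q)}
     else if {3,4} \<subseteq> q then {5,7,shift 9 n (Max q)}
     else {})" for q :: "nat set"
  let ?R = "route {1..n} {1,2,3} {4,5,6} {1,4,7} {2,5,8} \<rho>"
  note defs = \<rho>_def f12_def f45_def f48_def f78_def f18_def g35_def g26_def g25_def g14_def g36_def
    triples_atLeastAtMost max_def route_end_def
  have R127: "?R {1,2,7}"
    by (rule route_direct[of _ _ _ _ _ _ _ "{3,5,8}"]) (use n in \<open>simp_all add: defs\<close>)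
  have R468: "?R {4,6,8}"
    by (rule route_direct[of _ _ _ _ _ _ _ "{2,3,5}"]) (use n in \<open>simp_all add: defs\<close>)
  have R237: "?R {2,3,7}"
    by (rule route_direct[of _ _ _ _ _ _ _ "{1,4,6}"]) (use n in \<open>simp_all add: defs\<close>)
  have R478: "?R {4,7,8}"
    by (rule route_direct[of _ _ _ _ _ _ _ "{1,3,6}"]) (use n in \<open>simp_all add: defs\<close>)
  have R178: "?R {1,7,8}"
    by (rule route_direct[of _ _ _ _ _ _ _ "{2,3,6}"]) (use n in \<open>simp_all add: defs\<close>)
  have R457: "?R {4,5,7}"
    by (rule route_direct[of _ _ _ _ _ _ _ "{2,6,8}"]) (use n in \<open>simp_all add: defs\<close>)
  have R678: "?R {6,7,8}"
    by (rule route_direct[of _ _ _ _ _ _ _ "{1,3,4}"]) (use n in \<open>simp_all add: defs\<close>)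
  have R378: "?R {3,7,8}"
    by (rule route_via[of _ _ _ _ _ _ _ "{3,6,8}" "{1,2,4}"])
      (use n in \<open>simp_all add: defs\<close>)
  have R567: "?R {5,6,7}"
    by (rule route_via[of _ _ _ _ _ _ _ "{3,6,7}" "{2,4,8}"])
      (use n in \<open>simp_all add: defs\<close>)
  have R12: "?R (f12 r)" if "8 \<le> r" "r \<le> n" for r
    by (rule route_shift_star[OF that, of _ _ _ _ _ _ f12 g35])
      (use n in \<open>simp_all add: defs\<close>)
  have R45: "?R (f45 r)" if "8 \<le> r" "r \<le> n" for r
    by (rule route_shift_star[OF that, of _ _ _ _ _ _ f45 g26])
      (use n in \<open>simp_all add: defs\<close>)
  have R48: "?R (f48 r)" if "8 \<le> r" "r \<le> n" for r
    by (rule route_shift_star[OF that, of _ _ _ _ _ _ f48 g25])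
      (use n in \<open>simp_all add: defs\<close>)
  have R78: "?R (f78 r)" if "8 \<le> r" "r \<le> n" for r
    by (rule route_shift_star[OF that, of _ _ _ _ _ _ f78 g14])
      (use n in \<open>simp_all add: defs\<close>)
  have R18: "?R (f18 r)" if "8 \<le> r" "r \<le> n" for r
    by (rule route_shift_star[OF that, of _ _ _ _ _ _ f18 g36])
      (use n in \<open>simp_all add: defs\<close>)
  \<comment> \<open>This family and the next begin at 9, as \<open>{2,7,8}\<close> and
    \<open>{5,7,8}\<close> are exceptional values of \<open>f12\<close> and \<open>f78\<close>. For
    \<open>n = 9\<close> the sets \<open>{3,4,5}\<close> and \<open>{1,6,8}\<close> are the
    intermediate vertices.\<close>
  have R27: "?R {2,7,r}" if "9 \<le> r" "r \<le> n" for r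
    by (rule route_shift_via[OF that, of _ _ _ _ _ _ "\<lambda>z. {2,7,z}" "\<lambda>z. {1,6,z}" "{3,4,5}"])
      (use n in \<open>simp_all add: defs\<close>)
  have R57: "?R {5,7,r}" if "9 \<le> r" "r \<le> n" for r
    by (rule route_shift_via[OF that, of _ _ _ _ _ _ "\<lambda>z. {5,7,z}" "\<lambda>z. {3,4,z}" "{1,6,8}"])
      (use n in \<open>simp_all add: defs\<close>)
  have small: "?R {1,2,7}" "?R {1,2,8}" "?R {1,3,8}" "?R {1,7,8}" "?R {2,3,7}" "?R {2,7,8}"
    "?R {3,7,8}" "?R {4,5,7}" "?R {4,5,8}" "?R {4,6,8}" "?R {4,7,8}" "?R {5,6,7}" "?R {5,7,8}"
    "?R {6,7,8}"
    using R127 R468 R237 R478 R178 R457 R678 R378 R567 R12[of 8] R45[of 8] R48[of 8] R78[of 8]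
      R18[of 8] n
    by (simp_all add: f12_def f45_def f48_def f78_def f18_def)
  have big: "?R {1,2,r}" "?R {4,5,r}" "?R {4,8,r}" "?R {7,8,r}" "?R {1,8,r}" "?R {2,7,r}"
    "?R {5,7,r}"
    if "9 \<le> r" "r \<le> n" for r
    using R12[of r] R45[of r] R48[of r] R78[of r] R18[of r] R27[of r] R57[of r] that
    by (simp_all add: f12_def f45_def f48_def f78_def f18_def)
  show ?thesis
    unfolding routed_def
  proof (intro exI[of _ \<rho>] ballI impI, elim conjE)
    fix v assume v: "v \<in> triples {1..n}" "v \<noteq> {1,2,3}" "v \<noteq> {4,5,6}"
      and AB: "v \<inter> {1,2,3} = {} \<or> v \<inter> {4,5,6} = {}"
      and CD: "v \<inter> {1,4,7} \<noteq> {}" "v \<inter> {2,5,8} \<noteq> {}"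
    have range: "r = 1 \<or> r = 2 \<or> r = 3 \<or> r = 4 \<or> r = 5 \<or> r = 6 \<or> r = 7 \<or> r = 8 \<or> 9 \<le> r" "r \<le> n"
      if "r \<in> {1..n}" for r
      using that unfolding atLeastAtMost_iff by presburger+
    \<comment> \<open>The third point may be smaller than the other two; these rules bring such sets
      into the form used in \<open>small\<close> and \<open>big\<close>.\<close>
    have perm: "{4,8,5} = {4,5,8::nat}" "{4,8,6} = {4,6,8::nat}" "{4,8,7} = {4,7,8::nat}"
      "{7,5,r} = {5,7,r::nat}" "{5,7,4} = {4,5,7::nat}" "{5,7,6} = {5,6,7::nat}"
      "{7,8,4} = {4,7,8::nat}" "{7,8,5} = {5,7,8::nat}" "{7,8,6} = {6,7,8::nat}"
      "{1,8,2} = {1,2,8::nat}" "{1,8,3} = {1,3,8::nat}" "{1,8,7} = {1,7,8::nat}"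
      "{7,2,r} = {2,7,r::nat}" "{2,7,1} = {1,2,7::nat}" "{2,7,3} = {2,3,7::nat}"
      "{7,8,1} = {1,7,8::nat}" "{7,8,2} = {2,7,8::nat}" "{7,8,3} = {3,7,8::nat}" for r
      by auto
    from AB show "?R v"
    proof
      assume d: "v \<inter> {1,2,3} = {}"
      from CD obtain a b where ab: "a \<in> v" "b \<in> v" "a \<in> {1,4,7}" "b \<in> {2,5,8}" by blast
      with d have a: "a = 4 \<or> a = 7" and b: "b = 5 \<or> b = 8" by blast+
      then have "a \<noteq> b" by (elim disjE) simp_all
      from triples_third[OF v(1) ab(1,2) this] obtain r
        where r: "v = {a,b,r}" "r \<in> {1..n}" "r \<noteq> a" "r \<noteq> b" .
      have "r \<notin> {1,2,3}" using d r(1) by blast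
      with range[OF r(2)] have "r = 4 \<or> r = 5 \<or> r = 6 \<or> r = 7 \<or> r = 8 \<or> 9 \<le> r" by blast
      \<comment> \<open>\<open>One_nat_def\<close> would turn the literal 1 into
        \<open>Suc 0\<close>, after which \<open>small\<close> and \<open>big\<close> no longer
        match.\<close>
      then show "?R v"
        using a b v(3) r(3,4) range(2)[OF r(2)] unfolding r(1)
        by (elim disjE) (simp_all del: One_nat_def add: perm small big)
    next
      assume d: "v \<inter> {4,5,6} = {}"
      from CD obtain a b where ab: "a \<in> v" "b \<in> v" "a \<in> {1,4,7}" "b \<in> {2,5,8}" by blast
      with d have a: "a = 1 \<or> a = 7" and b: "b = 2 \<or> b = 8" by blast+
      then have "a \<noteq> b" by (elim disjE) simp_all
      from triples_third[OF v(1) ab(1,2) this] obtain r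
        where r: "v = {a,b,r}" "r \<in> {1..n}" "r \<noteq> a" "r \<noteq> b" .
      have "r \<notin> {4,5,6}" using d r(1) by blast
      with range[OF r(2)] have "r = 1 \<or> r = 2 \<or> r = 3 \<or> r = 7 \<or> r = 8 \<or> 9 \<le> r" by blast
      then show "?R v"
        using a b v(2) r(3,4) range(2)[OF r(2)] unfolding r(1)
        by (elim disjE) (simp_all del: One_nat_def add: perm small big)
    qed
  qed
qed

text \<open>The third point 2 of \<open>C\<close> lies in \<open>A\<close>, and only the third point
  7 of \<open>D\<close> lies outside \<open>A \<union> B\<close>. Hence the exceptional pairs now
  sit at index 7 and the variable points start at 8.\<close>

lemma routed_124_357:
  assumes n: "7 \<le> (n::nat)"
  shows "routed {1..n} {1,2,3} {4,5,6} {1,2,4} {3,5,7}"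
proof -
  define f13 where "f13 z = (if z = 7 then {1,3,7} else {1,3,z})" for z :: nat
  define g24 where "g24 z = (if z = 7 then {2,4,6} else {2,4,z})" for z :: nat
  define f23 where "f23 z = (if z = 7 then {2,3,7} else {2,3,z})" for z :: nat
  define g14 where "g14 z = (if z = 7 then {1,4,6} else {1,4,z})" for z :: nat
  define f27 where "f27 z = (if z = 7 then {1,2,7} else {2,7,z})" for z :: nat
  define g35 where "g35 z = (if z = 7 then {3,5,6} else {3,5,z})" for z :: nat
  define f45 where "f45 z = (if z = 7 then {4,5,7} else {4,5,z})" for z :: nat
  define g26 where "g26 z = (if z = 7 then {1,2,6} else {2,6,z})" for z :: nat
  define \<rho> where "\<rho> q =
    (if {3,6,7} \<subseteq> q then {4,6,7}
     else if {1,2,5} \<subseteq> q then {4,6,7}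
     else if {2,4,6} \<subseteq> q then f13 (shift 7 n 7)
     else if {1,4,6} \<subseteq> q then f23 (shift 7 n 7)
     else if {3,5,6} \<subseteq> q then f27 (shift 7 n 7)
     else if {1,2,6} \<subseteq> q then f45 (shift 7 n 7)
     else if {2,4,5} \<subseteq> q then {1,7,8}
     else if {2,3,5} \<subseteq> q then {4,7,8}
     else if {2,4} \<subseteq> q then f13 (shift 7 n (Max q))
     else if {1,4} \<subseteq> q then f23 (shift 7 n (Max q))
     else if {3,5} \<subseteq> q then f27 (shift 7 n (Max q))
     else if {2,6} \<subseteq> q then f45 (shift 7 n (Max q))
     else if {3,6} \<subseteq> q then {1,7,shift 8 n (Max q)}
     else if {1,6} \<subseteq> q then {4,7,shift 8 n (Max q)}
     else {})" for q :: "nat set"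
  let ?R = "route {1..n} {1,2,3} {4,5,6} {1,2,4} {3,5,7} \<rho>"
  note defs = \<rho>_def f13_def f23_def f27_def f45_def g24_def g14_def g35_def g26_def
    triples_atLeastAtMost max_def route_end_def
  have R467: "?R {4,6,7}"
    by (rule route_via[of _ _ _ _ _ _ _ "{3,6,7}" "{1,2,5}"])
      (use n in \<open>simp_all add: defs\<close>)
  have R13: "?R (f13 r)" if "7 \<le> r" "r \<le> n" for r
    by (rule route_shift_star[OF that, of _ _ _ _ _ _ f13 g24])
      (use n in \<open>simp_all add: defs\<close>)
  have R23: "?R (f23 r)" if "7 \<le> r" "r \<le> n" for r
    by (rule route_shift_star[OF that, of _ _ _ _ _ _ f23 g14])
      (use n in \<open>simp_all add: defs\<close>)
  have R27: "?R (f27 r)" if "7 \<le> r" "r \<le> n" for r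
    by (rule route_shift_star[OF that, of _ _ _ _ _ _ f27 g35])
      (use n in \<open>simp_all add: defs\<close>)
  have R45: "?R (f45 r)" if "7 \<le> r" "r \<le> n" for r
    by (rule route_shift_star[OF that, of _ _ _ _ _ _ f45 g26])
      (use n in \<open>simp_all add: defs\<close>)
  have R17: "?R {1,7,r}" if "8 \<le> r" "r \<le> n" for r
    by (rule route_shift_via[OF that, of _ _ _ _ _ _ "\<lambda>z. {1,7,z}" "\<lambda>z. {3,6,z}" "{2,4,5}"])
      (use n in \<open>simp_all add: defs\<close>)
  have R47: "?R {4,7,r}" if "8 \<le> r" "r \<le> n" for r
    by (rule route_shift_via[OF that, of _ _ _ _ _ _ "\<lambda>z. {4,7,z}" "\<lambda>z. {1,6,z}" "{2,3,5}"])
      (use n in \<open>simp_all add: defs\<close>)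
  have small: "?R {1,2,7}" "?R {1,3,7}" "?R {2,3,7}" "?R {4,5,7}" "?R {4,6,7}"
    using R467 R13[of 7] R23[of 7] R27[of 7] R45[of 7] n
    by (simp_all add: f13_def f23_def f27_def f45_def)
  have big: "?R {1,3,r}" "?R {2,3,r}" "?R {2,7,r}" "?R {4,5,r}" "?R {1,7,r}" "?R {4,7,r}"
    if "8 \<le> r" "r \<le> n" for r
    using R13[of r] R23[of r] R27[of r] R45[of r] R17[of r] R47[of r] that
    by (simp_all add: f13_def f23_def f27_def f45_def)
  show ?thesis
    unfolding routed_def
  proof (intro exI[of _ \<rho>] ballI impI, elim conjE)
    fix v assume v: "v \<in> triples {1..n}" "v \<noteq> {1,2,3}" "v \<noteq> {4,5,6}"
      and AB: "v \<inter> {1,2,3} = {} \<or> v \<inter> {4,5,6} = {}"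
      and CD: "v \<inter> {1,2,4} \<noteq> {}" "v \<inter> {3,5,7} \<noteq> {}"
    have range: "r = 1 \<or> r = 2 \<or> r = 3 \<or> r = 4 \<or> r = 5 \<or> r = 6 \<or> r = 7 \<or> 8 \<le> r" "r \<le> n"
      if "r \<in> {1..n}" for r
      using that unfolding atLeastAtMost_iff by presburger+
    have perm: "{4,7,5} = {4,5,7::nat}" "{4,7,6} = {4,6,7::nat}" "{1,3,2} = {1,2,3::nat}"
      "{1,7,2} = {1,2,7::nat}" "{1,7,3} = {1,3,7::nat}" "{2,3,1} = {1,2,3::nat}"
      "{2,7,1} = {1,2,7::nat}" "{2,7,3} = {2,3,7::nat}"
      by auto
    from AB show "?R v"
    proof
      assume d: "v \<inter> {1,2,3} = {}"
      from CD obtain a b where ab: "a \<in> v" "b \<in> v" "a \<in> {1,2,4}" "b \<in> {3,5,7}" by blast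
      with d have a: "a = 4" and b: "b = 5 \<or> b = 7" by blast+
      then have "a \<noteq> b" by (elim disjE) simp_all
      from triples_third[OF v(1) ab(1,2) this] obtain r
        where r: "v = {a,b,r}" "r \<in> {1..n}" "r \<noteq> a" "r \<noteq> b" .
      have "r \<notin> {1,2,3}" using d r(1) by blast
      with range[OF r(2)] have "r = 4 \<or> r = 5 \<or> r = 6 \<or> r = 7 \<or> 8 \<le> r" by blast
      then show "?R v"
        using a b v(3) r(3,4) range(2)[OF r(2)] unfolding r(1)
        by (elim disjE) (simp_all del: One_nat_def add: perm small big)
    next
      assume d: "v \<inter> {4,5,6} = {}"
      from CD obtain a b where ab: "a \<in> v" "b \<in> v" "a \<in> {1,2,4}" "b \<in> {3,5,7}" by blast
      with d have a: "a = 1 \<or> a = 2" and b: "b = 3 \<or> b = 7" by blast+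
      then have "a \<noteq> b" by (elim disjE) simp_all
      from triples_third[OF v(1) ab(1,2) this] obtain r
        where r: "v = {a,b,r}" "r \<in> {1..n}" "r \<noteq> a" "r \<noteq> b" .
      have "r \<notin> {4,5,6}" using d r(1) by blast
      with range[OF r(2)] have "r = 1 \<or> r = 2 \<or> r = 3 \<or> r = 7 \<or> 8 \<le> r" by blast
      then show "?R v"
        using a b v(2) r(3,4) range(2)[OF r(2)] unfolding r(1)
        by (elim disjE) (simp_all del: One_nat_def add: perm small big)
    qed
  qed
qed

text \<open>Now \<open>A \<union> B = C \<union> D\<close>, and the starts form the families
  \<open>{4,5,r}\<close>, \<open>{4,6,r}\<close>, \<open>{1,3,r}\<close>, \<open>{2,3,r}\<close>
  with \<open>r \<ge> 7\<close>. The shift serves them all unless \<open>n = 7\<close>, when each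
  family has a single member.\<close>

lemma routed_124_356:
  assumes n: "7 \<le> (n::nat)"
  shows "routed {1..n} {1,2,3} {4,5,6} {1,2,4} {3,5,6}"
proof -
  define \<rho> where "\<rho> q =
    (if {1,2,6} \<subseteq> q then {4,5,7}
     else if {1,2,5} \<subseteq> q then {4,6,7}
     else if {2,5,6} \<subseteq> q then {1,3,7}
     else if {1,5,6} \<subseteq> q then {2,3,7}
     else if {3,6} \<subseteq> q then (if n = 7 then {4,6,7} else {4,5,shift 7 n (Max q)})
     else if {3,5} \<subseteq> q then (if n = 7 then {4,5,7} else {4,6,shift 7 n (Max q)})
     else if {2,4} \<subseteq> q then (if n = 7 then {2,3,7} else {1,3,shift 7 n (Max q)})
     else if {1,4} \<subseteq> q then (if n = 7 then {1,3,7} else {2,3,shift 7 n (Max q)})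
     else {})" for q :: "nat set"
  let ?R = "route {1..n} {1,2,3} {4,5,6} {1,2,4} {3,5,6} \<rho>"
  note defs = \<rho>_def 
    triples_atLeastAtMost max_def route_end_def
  have R45: "?R {4,5,r}" if r: "7 \<le> r" "r \<le> n" for r
  proof (cases "n = 7")
    case True
    \<comment> \<open>The end \<open>{3,6,7}\<close> would leave only the points 1 and 2 for an
      intermediate set. So for \<open>n = 7\<close> the starts \<open>{4,5,7}\<close> and
      \<open>{4,6,7}\<close> exchange ends, and each then shares two points with its end. The starts
      \<open>{1,3,7}\<close> and \<open>{2,3,7}\<close> are treated alike.\<close>
    have "?R {4,5,7}"
      by (rule route_via[of _ _ _ _ _ _ _ "{3,5,7}" "{1,2,6}"]) (simp_all add: defs True)
    then show ?thesis using True r by simp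
  next
    case False
    show ?thesis
      by (rule route_shift_via[OF r, of _ _ _ _ _ _ "\<lambda>z. {4,5,z}" "\<lambda>z. {3,6,z}" "{1,2,6}"])
        (use n False in \<open>simp_all add: defs\<close>)
  qed
  have R46: "?R {4,6,r}" if r: "7 \<le> r" "r \<le> n" for r
  proof (cases "n = 7")
    case True
    have "?R {4,6,7}"
      by (rule route_via[of _ _ _ _ _ _ _ "{3,6,7}" "{1,2,5}"]) (simp_all add: defs True)
    then show ?thesis using True r by simp
  next
    case False
    show ?thesis
      by (rule route_shift_via[OF r, of _ _ _ _ _ _ "\<lambda>z. {4,6,z}" "\<lambda>z. {3,5,z}" "{1,2,5}"])
        (use n False in \<open>simp_all add: defs\<close>)
  qed
  have R13: "?R {1,3,r}" if r: "7 \<le> r" "r \<le> n" for r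
  proof (cases "n = 7")
    case True
    have "?R {1,3,7}"
      by (rule route_via[of _ _ _ _ _ _ _ "{1,4,7}" "{2,5,6}"]) (simp_all add: defs True)
    then show ?thesis using True r by simp
  next
    case False
    show ?thesis
      by (rule route_shift_via[OF r, of _ _ _ _ _ _ "\<lambda>z. {1,3,z}" "\<lambda>z. {2,4,z}" "{2,5,6}"])
        (use n False in \<open>simp_all add: defs\<close>)
  qed
  have R23: "?R {2,3,r}" if r: "7 \<le> r" "r \<le> n" for r
  proof (cases "n = 7")
    case True
    have "?R {2,3,7}"
      by (rule route_via[of _ _ _ _ _ _ _ "{2,4,7}" "{1,5,6}"]) (simp_all add: defs True)
    then show ?thesis using True r by simp
  next
    case False
    show ?thesis
      by (rule route_shift_via[OF r, of _ _ _ _ _ _ "\<lambda>z. {2,3,z}" "\<lambda>z. {1,4,z}" "{1,5,6}"])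
        (use n False in \<open>simp_all add: defs\<close>)
  qed
  have big: "?R {4,5,r}" "?R {4,6,r}" "?R {1,3,r}" "?R {2,3,r}"
    if "7 \<le> r" "r \<le> n" for r
    using R45[of r] R46[of r] R13[of r] R23[of r] that
    by simp_all
  show ?thesis
    unfolding routed_def
  proof (intro exI[of _ \<rho>] ballI impI, elim conjE)
    fix v assume v: "v \<in> triples {1..n}" "v \<noteq> {1,2,3}" "v \<noteq> {4,5,6}"
      and AB: "v \<inter> {1,2,3} = {} \<or> v \<inter> {4,5,6} = {}"
      and CD: "v \<inter> {1,2,4} \<noteq> {}" "v \<inter> {3,5,6} \<noteq> {}"
    have range: "r = 1 \<or> r = 2 \<or> r = 3 \<or> r = 4 \<or> r = 5 \<or> r = 6 \<or> 7 \<le> r" "r \<le> n"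
      if "r \<in> {1..n}" for r
      using that unfolding atLeastAtMost_iff by presburger+
    have perm: "{4,6,5} = {4,5,6::nat}" "{1,3,2} = {1,2,3::nat}" "{2,3,1} = {1,2,3::nat}"
      by auto
    from AB show "?R v"
    proof
      assume d: "v \<inter> {1,2,3} = {}"
      from CD obtain a b where ab: "a \<in> v" "b \<in> v" "a \<in> {1,2,4}" "b \<in> {3,5,6}" by blast
      with d have a: "a = 4" and b: "b = 5 \<or> b = 6" by blast+
      then have "a \<noteq> b" by (elim disjE) simp_all
      from triples_third[OF v(1) ab(1,2) this] obtain r
        where r: "v = {a,b,r}" "r \<in> {1..n}" "r \<noteq> a" "r \<noteq> b" .
      have "r \<notin> {1,2,3}" using d r(1) by blast
      with range[OF r(2)] have "r = 4 \<or> r = 5 \<or> r = 6 \<or> 7 \<le> r" by blast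
      then show "?R v"
        using a b v(3) r(3,4) range(2)[OF r(2)] unfolding r(1)
        by (elim disjE) (simp_all del: One_nat_def add: perm big)
    next
      assume d: "v \<inter> {4,5,6} = {}"
      from CD obtain a b where ab: "a \<in> v" "b \<in> v" "a \<in> {1,2,4}" "b \<in> {3,5,6}" by blast
      with d have a: "a = 1 \<or> a = 2" and b: "b = 3" by blast+
      then have "a \<noteq> b" by (elim disjE) simp_all
      from triples_third[OF v(1) ab(1,2) this] obtain r
        where r: "v = {a,b,r}" "r \<in> {1..n}" "r \<noteq> a" "r \<noteq> b" .
      have "r \<notin> {4,5,6}" using d r(1) by blast
      with range[OF r(2)] have "r = 1 \<or> r = 2 \<or> r = 3 \<or> 7 \<le> r" by blast
      then show "?R v"
        using a b v(2) r(3,4) range(2)[OF r(2)] unfolding r(1)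
        by (elim disjE) (simp_all del: One_nat_def add: perm big)
    qed
  qed
qed

section \<open>Transport of path systems along permutations\<close>

text \<open>Injectivity preserves cardinalities and emptiness of intersections, and
  \<open>\<rho>\<close> is conjugated by \<open>\<pi>\<close> so that starts are renamed along with
  inner vertices.\<close>

lemma route_image:
  assumes bij: "bij_betw \<pi> V W" and sub: "A \<subseteq> V" "B \<subseteq> V" "C \<subseteq> V" "D \<subseteq> V" "v \<subseteq> V"
    and "route V A B C D \<rho> v"
  shows "route W (\<pi> ` A) (\<pi> ` B) (\<pi> ` C) (\<pi> ` D) (\<lambda>q. \<pi> ` \<rho> (inv_into V \<pi> ` q)) (\<pi> ` v)"
proof -
  have inj: "inj_on \<pi> V" and im: "\<pi> ` V = W" using bij by (auto simp: bij_betw_def)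
  have disj: "\<pi> ` X \<inter> \<pi> ` Y = {} \<longleftrightarrow> X \<inter> Y = {}" if "X \<subseteq> V" "Y \<subseteq> V" for X Y
    using inj_on_image_Int[OF inj that] by (metis image_is_empty)
  have trip: "\<pi> ` q \<in> triples W" "q \<subseteq> V" "inv_into V \<pi> ` \<pi> ` q = q" if "q \<in> triples V" for q
  proof -
    show q: "q \<subseteq> V" using that by (simp add: triples_def)
    then have "card (\<pi> ` q) = card q" using inj by (meson card_image inj_on_subset)
    then show "\<pi> ` q \<in> triples W" using that im by (auto simp: triples_def)
    show "inv_into V \<pi> ` \<pi> ` q = q" using inj q by (rule inv_into_image_cancel)
  qed
  from assms(7) obtain q where q: "route_end V A B C D \<rho> v q"
    and via: "q \<inter> v = {} \<or>
      (\<exists>u \<in> triples V. u \<inter> A \<noteq> {} \<and> u \<inter> B \<noteq> {} \<and> u \<inter> q = {} \<and> u \<inter> v = {} \<and> \<rho> u = v)"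
    unfolding route_def by blast
  from q have qV: "q \<in> triples V" by (simp add: route_end_def)
  show ?thesis
    unfolding route_def
  proof (intro exI conjI)
    show "route_end W (\<pi> ` A) (\<pi> ` B) (\<pi> ` C) (\<pi> ` D) (\<lambda>q. \<pi> ` \<rho> (inv_into V \<pi> ` q)) (\<pi> ` v) (\<pi> ` q)"
      using q trip(1)[OF qV] by (simp only: simp_thms route_end_def trip(3)[OF qV] disj[OF trip(2)[OF qV]] sub)
    from via show "\<pi> ` q \<inter> \<pi> ` v = {} \<or> (\<exists>u \<in> triples W. u \<inter> \<pi> ` A \<noteq> {} \<and> u \<inter> \<pi> ` B \<noteq> {} \<and>
        u \<inter> \<pi> ` q = {} \<and> u \<inter> \<pi> ` v = {} \<and> \<pi> ` \<rho> (inv_into V \<pi> ` u) = \<pi> ` v)"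
    proof
      assume "q \<inter> v = {}"
      then show ?thesis by (simp only: simp_thms disj[OF trip(2)[OF qV] sub(5)])
    next
      assume "\<exists>u \<in> triples V. u \<inter> A \<noteq> {} \<and> u \<inter> B \<noteq> {} \<and> u \<inter> q = {} \<and> u \<inter> v = {} \<and> \<rho> u = v"
      then obtain u where u: "u \<in> triples V" "u \<inter> A \<noteq> {}" "u \<inter> B \<noteq> {}" "u \<inter> q = {}" "u \<inter> v = {}" "\<rho> u = v"
        by blast
      show ?thesis
        using u trip(1)[OF u(1)]
        by (intro disjI2 bexI[of _ "\<pi> ` u"])
          (simp_all only: simp_thms trip(2)[OF qV] trip(3)[OF u(1)] disj[OF trip(2)[OF u(1)]] sub)
    qed
  qed
qed

lemma routed_image:
  assumes bij: "bij_betw \<pi> V W" and sub: "A \<subseteq> V" "B \<subseteq> V" "C \<subseteq> V" "D \<subseteq> V"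
    and "routed V A B C D"
  shows "routed W (\<pi> ` A) (\<pi> ` B) (\<pi> ` C) (\<pi> ` D)"
proof -
  obtain \<rho> where \<rho>: "\<forall>v \<in> triples V. (v \<inter> A = {} \<or> v \<inter> B = {}) \<and> v \<noteq> A \<and> v \<noteq> B \<and> v \<inter> C \<noteq> {} \<and>
      v \<inter> D \<noteq> {} \<longrightarrow> route V A B C D \<rho> v"
    using assms(6) unfolding routed_def ..
  have inj: "inj_on \<pi> V" and im: "\<pi> ` V = W" using bij by (auto simp: bij_betw_def)
  have disj: "\<pi> ` X \<inter> \<pi> ` Y = {} \<longleftrightarrow> X \<inter> Y = {}" if "X \<subseteq> V" "Y \<subseteq> V" for X Y
    using inj_on_image_Int[OF inj that] by (metis image_is_empty)
  show ?thesis
    unfolding routed_def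
  proof (intro exI ballI impI, elim conjE)
    fix w assume w: "w \<in> triples W" and
      AB: "w \<inter> \<pi> ` A = {} \<or> w \<inter> \<pi> ` B = {}" "w \<noteq> \<pi> ` A" "w \<noteq> \<pi> ` B"
      and CD: "w \<inter> \<pi> ` C \<noteq> {}" "w \<inter> \<pi> ` D \<noteq> {}"
    obtain v where v: "v \<subseteq> V" "w = \<pi> ` v"
      using w im by (metis (no_types, lifting) mem_Collect_eq subset_imageE triples_def)
    have "v \<in> triples V"
      using w v inj card_image[of \<pi> v] by (simp add: triples_def inj_on_subset)
    then have "route V A B C D \<rho> v"
      using \<rho> AB CD unfolding v(2) by (simp only: simp_thms disj[OF v(1)] sub) metis
    then show "route W (\<pi> ` A) (\<pi> ` B) (\<pi> ` C) (\<pi> ` D) (\<lambda>q. \<pi> ` \<rho> (inv_into V \<pi> ` q)) w"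
      unfolding v(2) using route_image[OF bij sub v(1)] by blast
  qed
qed

text \<open>All conditions are symmetric in \<open>A\<close> and \<open>B\<close>, so the same
  \<open>\<rho>\<close> serves. With the analogous symmetry in \<open>C\<close> and
  \<open>D\<close>, this reduces all configurations to the three computed ones.\<close>

lemma routed_swap_left: "routed V A B C D \<longleftrightarrow> routed V B A C D"
  unfolding routed_def route_def route_end_def by (simp add: conj_ac disj_ac)

lemma routed_swap_right: "routed V A B C D \<longleftrightarrow> routed V A B D C"
  unfolding routed_def route_def route_end_def by (simp add: conj_ac disj_ac)

text \<open>Position \<open>i\<close>, counted from 1, goes to the corresponding entry of
  \<open>xs\<close>; the remaining points are matched by any bijection between the two complements,
  which have equal size.\<close>

lemma relabelling:
  fixes xs :: "nat list"
  assumes "distinct xs" "set xs \<subseteq> {1..n}"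
  obtains \<pi> where "bij_betw \<pi> {1..n} {1..n}" "\<forall>i < length xs. \<pi> (Suc i) = xs ! i"
proof -
  have len: "length xs \<le> n"
    using card_mono[OF _ assms(2)] distinct_card[OF assms(1)] by simp
  have "bij_betw (\<lambda>i. i - 1) {1..length xs} {..<length xs}"
    by (rule bij_betw_byWitness[where f' = Suc]) auto
  then have "bij_betw (\<lambda>i. xs ! (i - 1)) {1..length xs} (set xs)"
    using bij_betw_trans[OF _ bij_betw_nth[OF assms(1) refl refl]] by (simp add: comp_def)
  moreover have "card ({1..n} - {1..length xs}) = card ({1..n} - set xs)"
    using assms len by (simp add: card_Diff_subset distinct_card)
  then obtain h where "bij_betw h ({1..n} - {1..length xs}) ({1..n} - set xs)"
    using finite_same_card_bij by (metis finite_Diff finite_atLeastAtMost)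
  ultimately have "bij_betw (\<lambda>i. if i \<in> {1..length xs} then xs ! (i - 1) else h i)
      ({1..length xs} \<union> ({1..n} - {1..length xs})) (set xs \<union> ({1..n} - set xs))"
    by (intro bij_betw_disjoint_Un) auto
  moreover have "{1..length xs} \<union> ({1..n} - {1..length xs}) = {1..n}" using len by auto
  moreover have "set xs \<union> ({1..n} - set xs) = {1..n}" using assms by auto
  ultimately show thesis
    by (intro that) auto
qed

text \<open>The name tells where the third points \<open>p7\<close> and \<open>p8\<close> lie
  relative to the first edge. The eight distinct points force \<open>8 \<le> n\<close>.\<close>

lemma routed_outside_outside:
  fixes p1 p2 p3 p4 p5 p6 p7 p8 :: nat
  assumes "distinct [p1, p2, p3, p4, p5, p6, p7, p8]" "set [p1, p2, p3, p4, p5, p6, p7, p8] \<subseteq> {1..n}"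
  shows "routed {1..n} {p1,p2,p3} {p4,p5,p6} {p1,p4,p7} {p2,p5,p8}"
proof -
  obtain \<pi> where \<pi>: "bij_betw \<pi> {1..n} {1..n}"
    and p: "\<forall>i < length [p1, p2, p3, p4, p5, p6, p7, p8]. \<pi> (Suc i) = [p1, p2, p3, p4, p5, p6, p7, p8] ! i"
    using relabelling[OF assms] .
  have n: "8 \<le> n"
    using card_mono[OF _ assms(2)] distinct_card[OF assms(1)] by simp
  have "\<pi> 1 = p1" "\<pi> 2 = p2" "\<pi> 3 = p3" "\<pi> 4 = p4" "\<pi> 5 = p5" "\<pi> 6 = p6" "\<pi> 7 = p7" "\<pi> 8 = p8"
    using p[rule_format, of 0] p[rule_format, of 1] p[rule_format, of 2] p[rule_format, of 3]
      p[rule_format, of 4] p[rule_format, of 5] p[rule_format, of 6] p[rule_format, of 7]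
    by (simp_all add: numeral_eq_Suc)
  then show ?thesis
    using routed_image[OF \<pi> _ _ _ _ routed_147_258[OF n]] n by simp
qed

lemma routed_inside_outside:
  fixes p1 p2 p3 p4 p5 p6 p7 :: nat
  assumes "distinct [p1, p2, p3, p4, p5, p6, p7]" "set [p1, p2, p3, p4, p5, p6, p7] \<subseteq> {1..n}"
  shows "routed {1..n} {p1,p2,p3} {p4,p5,p6} {p1,p2,p4} {p3,p5,p7}"
proof -
  obtain \<pi> where \<pi>: "bij_betw \<pi> {1..n} {1..n}"
    and p: "\<forall>i < length [p1, p2, p3, p4, p5, p6, p7]. \<pi> (Suc i) = [p1, p2, p3, p4, p5, p6, p7] ! i"
    using relabelling[OF assms] .
  have n: "7 \<le> n"
    using card_mono[OF _ assms(2)] distinct_card[OF assms(1)] by simp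
  have "\<pi> 1 = p1" "\<pi> 2 = p2" "\<pi> 3 = p3" "\<pi> 4 = p4" "\<pi> 5 = p5" "\<pi> 6 = p6" "\<pi> 7 = p7"
    using p[rule_format, of 0] p[rule_format, of 1] p[rule_format, of 2] p[rule_format, of 3]
      p[rule_format, of 4] p[rule_format, of 5] p[rule_format, of 6]
    by (simp_all add: numeral_eq_Suc)
  then show ?thesis
    using routed_image[OF \<pi> _ _ _ _ routed_124_357[OF n]] n by simp
qed

text \<open>Six distinct points give only \<open>6 \<le> n\<close>, so \<open>7 \<le> n\<close> is
  assumed separately.\<close>

lemma routed_inside_inside:
  fixes p1 p2 p3 p4 p5 p6 :: nat
  assumes "distinct [p1, p2, p3, p4, p5, p6]" "set [p1, p2, p3, p4, p5, p6] \<subseteq> {1..n}" and n: "7 \<le> n"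
  shows "routed {1..n} {p1,p2,p3} {p4,p5,p6} {p1,p2,p4} {p3,p5,p6}"
proof -
  obtain \<pi> where \<pi>: "bij_betw \<pi> {1..n} {1..n}"
    and p: "\<forall>i < length [p1, p2, p3, p4, p5, p6]. \<pi> (Suc i) = [p1, p2, p3, p4, p5, p6] ! i"
    using relabelling[OF assms(1,2)] .
  have "\<pi> 1 = p1" "\<pi> 2 = p2" "\<pi> 3 = p3" "\<pi> 4 = p4" "\<pi> 5 = p5" "\<pi> 6 = p6"
    using p[rule_format, of 0] p[rule_format, of 1] p[rule_format, of 2] p[rule_format, of 3]
      p[rule_format, of 4] p[rule_format, of 5]
    by (simp_all add: numeral_eq_Suc)
  then show ?thesis
    using routed_image[OF \<pi> _ _ _ _ routed_124_356[OF n]] n by simp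
qed

section \<open>The size of a separating set\<close>

text \<open>One point from each of the four intersections determines two points of each of
  \<open>A\<close>, \<open>B\<close>, \<open>C\<close>, \<open>D\<close>. The configuration then
  depends only on where the third points \<open>c\<close> and \<open>d\<close> lie.\<close>

lemma routed_cross_intersecting:
  assumes n: "7 \<le> (n::nat)" and tr: "A \<in> triples {1..n}" "B \<in> triples {1..n}" "C \<in> triples {1..n}" "D \<in> triples {1..n}"
    and AB: "A \<inter> B = {}" and CD: "C \<inter> D = {}"
    and ne: "A \<inter> C \<noteq> {}" "A \<inter> D \<noteq> {}" "B \<inter> C \<noteq> {}" "B \<inter> D \<noteq> {}"
  shows "routed {1..n} A B C D"
proof -
  obtain a a' b b' where el: "a \<in> A" "a \<in> C" "a' \<in> A" "a' \<in> D" "b \<in> B" "b \<in> C" "b' \<in> B" "b' \<in> D"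
    using ne by blast
  have ne1: "a \<noteq> a'" "b \<noteq> b'" "a \<noteq> b" "a' \<noteq> b'" "a \<noteq> b'" "a' \<noteq> b"
    using el AB CD by blast+
  obtain a'' where A: "A = {a,a',a''}" "a'' \<in> {1..n}" "a'' \<noteq> a" "a'' \<noteq> a'"
    using triples_third[OF tr(1) el(1,3) ne1(1)] .
  obtain b'' where B: "B = {b,b',b''}" "b'' \<in> {1..n}" "b'' \<noteq> b" "b'' \<noteq> b'"
    using triples_third[OF tr(2) el(5,7) ne1(2)] .
  obtain c where C: "C = {a,b,c}" "c \<in> {1..n}" "c \<noteq> a" "c \<noteq> b"
    using triples_third[OF tr(3) el(2,6) ne1(3)] .
  obtain d where D: "D = {a',b',d}" "d \<in> {1..n}" "d \<noteq> a'" "d \<noteq> b'"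
    using triples_third[OF tr(4) el(4,8) ne1(4)] .
  have ne2: "a'' \<noteq> b" "a'' \<noteq> b'" "b'' \<noteq> a" "b'' \<noteq> a'" "a'' \<noteq> b''"
    using AB unfolding A(1) B(1) by blast+
  have ne3: "c \<noteq> a'" "c \<noteq> b'" "d \<noteq> a" "d \<noteq> b" "c \<noteq> d"
    using CD unfolding C(1) D(1) by blast+
  have "{a,a',b,b'} \<subseteq> {1..n}"
    using el tr unfolding triples_def by blast
  then have rng: "{a,a',a'',b,b',b'',c,d} \<subseteq> {1..n}"
    using A(2) B(2) C(2) D(2) by blast
  note dist = ne1 ne2 ne3 A(3,4) B(3,4) C(3,4) D(3,4)
  note dist' = dist dist[symmetric]
  \<comment> \<open>Each of \<open>c\<close> and \<open>d\<close> is \<open>a''\<close>,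
    \<open>b''\<close> or outside \<open>A \<union> B\<close>; excluding \<open>c = d = a''\<close>
    and \<open>c = d = b''\<close> leaves seven of the nine combinations.\<close>
  consider "a'' \<noteq> c" "b'' \<noteq> c" "a'' \<noteq> d" "b'' \<noteq> d" | "c = a''" "a'' \<noteq> d" "b'' \<noteq> d" | "c = b''" "a'' \<noteq> d" "b'' \<noteq> d"
    | "a'' \<noteq> c" "b'' \<noteq> c" "d = a''" | "a'' \<noteq> c" "b'' \<noteq> c" "d = b''" | "c = a''" "d = b''" | "c = b''" "d = a''"
    using ne3(5) by blast
  then show ?thesis
  proof cases
    case 1
    have "routed {1..n} {a,a',a''} {b,b',b''} {a,b,c} {a',b',d}"
      by (rule routed_outside_outside) (use 1 dist' rng in \<open>simp_all\<close>)
    then show ?thesis unfolding A(1) B(1) C(1) D(1) .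
  next
    case 2
    have "routed {1..n} {a,a'',a'} {b,b',b''} {a,a'',b} {a',b',d}"
      by (rule routed_inside_outside) (use 2 dist' rng in \<open>simp_all\<close>)
    then show ?thesis unfolding A(1) B(1) C(1) D(1) 2(1) by (simp add: insert_commute)
  next
    case 3
    have "routed {1..n} {b,b'',b'} {a,a',a''} {b,b'',a} {b',a',d}"
      by (rule routed_inside_outside) (use 3 dist' rng in \<open>simp_all\<close>)
    then show ?thesis
      unfolding A(1) B(1) C(1) D(1) 3(1) routed_swap_left[of _ "{a,a',a''}"] by (simp add: insert_commute)
  next
    case 4
    have "routed {1..n} {a',a'',a} {b',b,b''} {a',a'',b'} {a,b,c}"
      by (rule routed_inside_outside) (use 4 dist' rng in \<open>simp_all\<close>)
    then show ?thesis
      unfolding A(1) B(1) C(1) D(1) 4(3) routed_swap_right[of _ _ _ "{a,b,c}"] by (simp add: insert_commute)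
  next
    case 5
    have "routed {1..n} {b',b'',b} {a',a,a''} {b',b'',a'} {b,a,c}"
      by (rule routed_inside_outside) (use 5 dist' rng in \<open>simp_all\<close>)
    then show ?thesis
      unfolding A(1) B(1) C(1) D(1) 5(3) routed_swap_left[of _ "{a,a',a''}"] routed_swap_right[of _ _ _ "{a,b,c}"]
      by (simp add: insert_commute)
  next
    case 6
    have "routed {1..n} {a,a'',a'} {b,b',b''} {a,a'',b} {a',b',b''}"
      by (rule routed_inside_inside) (use 6 dist' rng n in \<open>simp_all\<close>)
    then show ?thesis unfolding A(1) B(1) C(1) D(1) 6 by (simp add: insert_commute)
  next
    case 7
    have "routed {1..n} {b,b'',b'} {a,a',a''} {b,b'',a} {b',a',a''}"
      by (rule routed_inside_inside) (use 7 dist' rng n in \<open>simp_all\<close>)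
    then show ?thesis
      unfolding A(1) B(1) C(1) D(1) 7 routed_swap_left[of _ "{a,a',a''}"] by (simp add: insert_commute)
  qed
qed

section \<open>Neighbourhoods of edges: the Menger bound and the count\<close>

definition edge_nbrs :: "'a set \<Rightarrow> 'a set \<Rightarrow> 'a set \<Rightarrow> 'a set set" where
  "edge_nbrs V A B = {v \<in> triples V. (v \<inter> A = {} \<or> v \<inter> B = {}) \<and> v \<noteq> A \<and> v \<noteq> B}"

text \<open>Every path leads from the side of \<open>X\<close> to the side of \<open>Y\<close> and
  therefore hits \<open>S\<close>. Sending each vertex to the start of its path thus maps
  \<open>S\<close> onto a superset of the neighbourhood.\<close>

lemma card_edge_nbrs_le:
  assumes routed: "routed V A B C D" and fin: "finite S"
    and cover: "\<And>v. v \<in> triples V \<Longrightarrow> v \<in> X \<or> v \<in> Y \<or> v \<in> S"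
    and cross: "\<And>x y. x \<in> X \<Longrightarrow> y \<in> Y \<Longrightarrow> x \<inter> y \<noteq> {}"
    and mem: "A \<in> X" "B \<in> X" "C \<in> Y" "D \<in> Y"
  shows "card (edge_nbrs V A B) \<le> card S"
proof -
  obtain \<rho> where \<rho>: "\<forall>v \<in> triples V. (v \<inter> A = {} \<or> v \<inter> B = {}) \<and> v \<noteq> A \<and> v \<noteq> B \<and> v \<inter> C \<noteq> {} \<and>
      v \<inter> D \<noteq> {} \<longrightarrow> route V A B C D \<rho> v"
    using routed unfolding routed_def ..
  \<comment> \<open>Starts own themselves; sets meeting both \<open>A\<close> and \<open>B\<close>
    can only be inner vertices and are handled by \<open>\<rho>\<close>.\<close>
  define owner where "owner s = (if s \<inter> A = {} \<or> s \<inter> B = {} then s else \<rho> s)" for s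
  have near_X: "v \<in> X \<or> v \<in> S" if "v \<in> triples V" "v \<inter> A = {} \<or> v \<inter> B = {}" for v
    using cover[OF that(1)] cross[OF mem(1)] cross[OF mem(2)] that(2) by (metis Int_commute)
  have near_Y: "v \<in> Y \<or> v \<in> S" if "v \<in> triples V" "v \<inter> C = {} \<or> v \<inter> D = {}" for v
    using cover[OF that(1)] cross[OF _ mem(3)] cross[OF _ mem(4)] that(2) by metis
  have "v \<in> owner ` S" if v: "v \<in> edge_nbrs V A B" for v
  proof -
    have vV: "v \<in> triples V" and vAB: "v \<inter> A = {} \<or> v \<inter> B = {}" and "v \<noteq> A" "v \<noteq> B"
      using v by (simp_all add: edge_nbrs_def)
    have own: "owner v = v" using vAB by (simp add: owner_def)
    show ?thesis
    proof (cases "v \<in> S")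
      case True
      with own show ?thesis by (metis image_eqI)
    next
      case False
      then have vX: "v \<in> X" using near_X[OF vV vAB] by simp
      then have "v \<inter> C \<noteq> {}" "v \<inter> D \<noteq> {}" using cross mem by simp_all
      with \<rho> vV vAB \<open>v \<noteq> A\<close> \<open>v \<noteq> B\<close> have "route V A B C D \<rho> v" by simp
      then obtain q where q: "route_end V A B C D \<rho> v q" and via: "q \<inter> v = {} \<or>
          (\<exists>u \<in> triples V. u \<inter> A \<noteq> {} \<and> u \<inter> B \<noteq> {} \<and> u \<inter> q = {} \<and> u \<inter> v = {} \<and> \<rho> u = v)"
        unfolding route_def by auto
      have q': "q \<in> triples V" "q \<inter> C = {} \<or> q \<inter> D = {}" "owner q = v"
        using q by (simp_all add: route_end_def owner_def)
      show ?thesis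
      proof (cases "q \<in> S")
        case True
        with q'(3) show ?thesis by (metis image_eqI)
      next
        case False
        with near_Y[OF q'(1,2)] have qY: "q \<in> Y" by simp
        then have "q \<inter> v \<noteq> {}" using cross[OF vX qY] by (simp add: Int_commute)
        with via obtain u where u: "u \<in> triples V" "u \<inter> A \<noteq> {}" "u \<inter> B \<noteq> {}" "u \<inter> q = {}" "u \<inter> v = {}" "\<rho> u = v"
          by auto
        \<comment> \<open>\<open>u\<close> is adjacent to \<open>q\<close> in \<open>Y\<close> and
          to \<open>v\<close> in \<open>X\<close>, hence lies on neither side.\<close>
        have "u \<notin> X" using cross[OF _ qY] u(4) by blast
        moreover have "u \<notin> Y" using cross[OF vX] u(5) by (metis Int_commute)
        ultimately have "u \<in> S" using cover[OF u(1)] by simp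
        moreover have "owner u = v" using u by (simp add: owner_def)
        ultimately show ?thesis by (metis image_eqI)
      qed
    qed
  qed
  then have "edge_nbrs V A B \<subseteq> owner ` S" by (rule subsetI)
  with fin show ?thesis by (rule surj_card_le)
qed

lemma card_triples_disjoint:
  assumes "finite V" "A \<subseteq> V"
  shows "card {v \<in> triples V. v \<inter> A = {}} = (card V - card A) choose 3"
proof -
  have "{v \<in> triples V. v \<inter> A = {}} = {v. v \<subseteq> V - A \<and> card v = 3}"
    by (auto simp: triples_def)
  then show ?thesis
    using assms by (simp add: n_subsets card_Diff_subset finite_subset)
qed

text \<open>Inclusion-exclusion for the neighbourhoods \<open>P\<close> of \<open>A\<close> and
  \<open>Q\<close> of \<open>B\<close>; the union contains \<open>A\<close> and \<open>B\<close>
  themselves, which accounts for the subtracted 2.\<close>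

lemma card_edge_nbrs:
  assumes "finite V" "A \<in> triples V" "B \<in> triples V" "A \<inter> B = {}"
  shows "card (edge_nbrs V A B) = 2 * (((card V - 3) choose 3) - 1) - ((card V - 6) choose 3)"
proof -
  have sub: "A \<subseteq> V" "B \<subseteq> V" and c: "card A = 3" "card B = 3"
    using assms by (auto simp: triples_def)
  then have fin: "finite A" "finite B" using assms(1) finite_subset by auto
  define P where "P = {v \<in> triples V. v \<inter> A = {}}"
  define Q where "Q = {v \<in> triples V. v \<inter> B = {}}"
  have "finite (triples V)"
    by (rule finite_subset[of _ "Pow V"]) (use assms(1) in \<open>auto simp: triples_def\<close>)
  then have finPQ: "finite P" "finite Q" by (simp_all add: P_def Q_def)
  have cP: "card P = (card V - 3) choose 3" "card Q = (card V - 3) choose 3"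
    using card_triples_disjoint[OF assms(1)] sub c by (simp_all add: P_def Q_def)
  have "P \<inter> Q = {v \<in> triples V. v \<inter> (A \<union> B) = {}}"
    by (auto simp: P_def Q_def)
  moreover have "card (A \<union> B) = 6" using c fin assms(4) by (simp add: card_Un_disjoint)
  ultimately have cPQ: "card (P \<inter> Q) = (card V - 6) choose 3"
    using card_triples_disjoint[OF assms(1), of "A \<union> B"] sub by simp
  have AB: "A \<in> Q" "B \<in> P" "A \<noteq> B"
    using assms c by (auto simp: P_def Q_def)
  have "edge_nbrs V A B = (P \<union> Q) - {A, B}"
    by (auto simp: edge_nbrs_def P_def Q_def)
  then have "card (edge_nbrs V A B) = card (P \<union> Q) - 2"
    using AB by (simp add: card_Diff_subset)
  moreover have "card (P \<union> Q) + card (P \<inter> Q) = card P + card Q"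
    using card_Un_Int[OF finPQ] by simp
  ultimately show ?thesis unfolding cP cPQ by arith
qed

section \<open>Super vertex cuts of the Kneser graph\<close>

lemma verts_kneser_3: "verts (with_proj (kneser_graph n 3)) = triples {1..n}"
  by (simp add: kneser_graph_def triples_def)

lemma arcs_ends_induce_kneser_3:
  assumes "W \<subseteq> triples {1..n}"
  shows "u \<rightarrow>\<^bsub>with_proj (kneser_graph n 3) \<restriction> W\<^esub> v \<longleftrightarrow> u \<in> W \<and> v \<in> W \<and> u \<inter> v = {}"
  using assms by (auto simp: arcs_ends_conv kneser_graph_def triples_def)

lemma sym_digraph_induce_kneser_3:
  assumes "W \<subseteq> triples {1..n}"
  shows "sym_digraph (with_proj (kneser_graph n 3) \<restriction> W)"
proof -
  interpret G: graph "with_proj (kneser_graph n 3)" by (rule graph_kneser_graph) simp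
  show ?thesis
    by (rule G.induced_graph_imp_graph, rule G.induced_induce) (use assms in \<open>simp only: verts_kneser_3\<close>)
qed

section \<open>Connectedness and components of symmetric digraphs\<close>

text \<open>\<open>connected\<close> refers to the symmetric closure, which has the same
  reachability here. The graph without vertices has to be excluded because it does not count as
  connected.\<close>

lemma (in sym_digraph) not_connected_obtain:
  assumes "\<not> connected G" "verts G \<noteq> {}"
  obtains u w where "u \<in> verts G" "w \<in> verts G" "\<not> u \<rightarrow>\<^sup>* w"
proof -
  have "\<not> strongly_connected (mk_symmetric G)" using assms(1) by (simp add: connected_def)
  then have "\<exists>u \<in> verts G. \<exists>w \<in> verts G. \<not> u \<rightarrow>\<^sup>*\<^bsub>mk_symmetric G\<^esub> w"
    using assms(2) by (simp add: strongly_connected_def)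
  then show thesis
    using that reachable_mk_symmetric_eq[OF sym_arcs] by blast
qed

text \<open>The vertices reachable from \<open>v\<close> form a component. It has a vertex other
  than \<open>v\<close>, and a walk to that vertex begins with an arc at \<open>v\<close>.\<close>

lemma (in sym_digraph) ex_dominated_if_no_trivial_scc:
  assumes "\<forall>C \<in> sccs. \<not> (\<exists>v. verts C = {v})" "v \<in> verts G"
  obtains w where "v \<rightarrow> w"
proof -
  have "\<not> (\<exists>x. verts (G \<restriction> {w. v \<rightarrow>\<^sup>* w}) = {x})"
    using assms(1) induce_reachable_is_in_sccs[OF assms(2)] by (rule bspec)
  then have "{w. v \<rightarrow>\<^sup>* w} \<noteq> {v}" unfolding induce_subgraph_verts by iprover
  then obtain w where w: "v \<rightarrow>\<^sup>* w" "w \<noteq> v"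
    using reachable_refl[OF assms(2)] by (metis (mono_tags) Collect_cong singleton_conv)
  from w(1) show thesis
  proof (cases rule: converse_reachable_cases)
    case base
    with w(2) show thesis by simp
  next
    case (step x)
    from that[OF this(1)] show thesis .
  qed
qed

text \<open>Arcs can be reversed, so \<open>v\<close> and its neighbour \<open>w\<close> reach each
  other and share a component.\<close>

lemma (in sym_digraph) no_trivial_scc:
  assumes "\<And>v. v \<in> verts G \<Longrightarrow> \<exists>w. w \<noteq> v \<and> v \<rightarrow> w"
  shows "\<forall>C \<in> sccs. \<not> (\<exists>v. verts C = {v})"
proof (intro ballI notI, elim exE)
  fix C v assume C: "C \<in> sccs" "verts C = {v}"
  then obtain T where T: "T \<in> sccs_verts" "T = {v}"
    by (auto simp: sccs_conv_sccs_verts)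
  have "v \<in> verts G"
    using subgraph_imp_subverts[OF induced_imp_subgraph[OF in_sccs_imp_induced[OF C(1)]]] C(2) by simp
  then obtain w where w: "w \<noteq> v" "v \<rightarrow> w" using assms by blast
  then have "v \<rightarrow>\<^sup>* w" "w \<rightarrow>\<^sup>* v" using graph_symmetric by auto
  then show False using T w(1) unfolding in_sccs_verts_conv_reachable by blast
qed

text \<open>Let \<open>X\<close> be the part of \<open>W\<close> reachable from \<open>A\<close>. No
  set in \<open>X\<close> is disjoint from one in \<open>W - X\<close>, and both contain an edge, so
  the path systems apply. The bound is stated for general \<open>W\<close> because
  \<open>W = triples {1..n}\<close> yields connectedness of the graph.\<close>

lemma card_complement_ge:
  assumes n: "7 \<le> n" and W: "W \<subseteq> triples {1..n}" "W \<noteq> {}"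
    and disconn: "\<not> connected (with_proj (kneser_graph n 3) \<restriction> W)"
    and nbr: "\<And>v. v \<in> W \<Longrightarrow> \<exists>w \<in> W. v \<inter> w = {}"
  shows "2 * (((n - 3) choose 3) - 1) - ((n - 6) choose 3) \<le> card (triples {1..n} - W)"
proof -
  interpret H: sym_digraph "with_proj (kneser_graph n 3) \<restriction> W"
    by (rule sym_digraph_induce_kneser_3[OF W(1)])
  let ?reach = "\<lambda>u v. u \<rightarrow>\<^sup>*\<^bsub>with_proj (kneser_graph n 3) \<restriction> W\<^esub> v"
  note adj = arcs_ends_induce_kneser_3[OF W(1)]
  obtain A C where AC: "A \<in> W" "C \<in> W" "\<not> ?reach A C"
    using H.not_connected_obtain[OF disconn] W(2) by auto
  obtain B where B: "B \<in> W" "A \<inter> B = {}" using nbr[OF AC(1)] by blast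
  obtain D where D: "D \<in> W" "C \<inter> D = {}" using nbr[OF AC(2)] by blast
  define X where "X = {v \<in> W. ?reach A v}"
  have step: "?reach A v" if "?reach A u" "u \<in> W" "v \<in> W" "u \<inter> v = {}" for u v
    using H.reachable_adj_trans[OF that(1)] adj that by blast
  have "?reach A A" using AC(1) by simp
  then have X: "A \<in> X" "B \<in> X" using step[OF _ AC(1) B] AC(1) B(1) by (simp_all add: X_def)
  have Y: "C \<in> W - X" "D \<in> W - X"
    using AC(2,3) D step[OF _ D(1) AC(2)] by (auto simp: X_def Int_commute)
  have cross: "x \<inter> y \<noteq> {}" if "x \<in> X" "y \<in> W - X" for x y
    using that step by (auto simp: X_def)
  have "routed {1..n} A B C D"
    using n B(2) D(2) cross X Y AC B(1) D(1) W(1) by (intro routed_cross_intersecting) auto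
  moreover have "finite (triples {1..n} - W)"
    by (rule finite_subset[of _ "Pow {1..n}"]) (auto simp: triples_def)
  ultimately have "card (edge_nbrs {1..n} A B) \<le> card (triples {1..n} - W)"
    by (rule card_edge_nbrs_le[where X = X and Y = "W - X"]) (use cross X Y in auto)
  moreover have "A \<in> triples {1..n}" "B \<in> triples {1..n}" using AC(1) B(1) W(1) by blast+
  ultimately show ?thesis
    using card_edge_nbrs[of "{1..n}" A B] B(2) by simp
qed

text \<open>Otherwise \<open>card_complement_ge\<close> with nothing deleted would make the bound 0.
  Writing p and c for its two binomials, c \<le> p and p \<ge> 4 give 2(p - 1) - c \<ge> p - 2 \<ge>
  2.\<close>

lemma connected_kneser_3:
  assumes n: "7 \<le> n"
  shows "connected (with_proj (kneser_graph n 3))"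
proof (rule ccontr)
  let ?G = "with_proj (kneser_graph n 3)"
  assume not_conn: "\<not> connected ?G"
  interpret G: graph ?G by (rule graph_kneser_graph) simp
  have "?G \<restriction> triples {1..n} = ?G"
    using G.wellformed
    by (simp add: induce_subgraph_def kneser_graph_def triples_def with_proj_def) auto
  moreover have "\<exists>w \<in> triples {1..n}. v \<inter> w = {}" if "v \<in> triples {1..n}" for v
  proof -
    have "3 \<le> card ({1..n} - v)"
      using that n by (simp add: triples_def card_Diff_subset finite_subset[of v "{1..n}"])
    then obtain w where "w \<subseteq> {1..n} - v" "card w = 3" by (rule obtain_subset_with_card_n)
    then show ?thesis by (auto simp: triples_def)
  qed
  moreover have "{1,2,3} \<in> triples {1..n}" using n by (simp add: triples_def)
  ultimately have "2 * (((n - 3) choose 3) - 1) - ((n - 6) choose 3) \<le> 0"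
    using card_complement_ge[OF n, of "triples {1..n}"] not_conn by auto
  moreover have "(n - 6) choose 3 \<le> (n - 3) choose 3" "(4 choose 3) \<le> (n - 3) choose 3"
    using n by (intro binomial_right_mono; simp)+
  ultimately show False by (simp add: numeral_eq_Suc)
qed

text \<open>Deleting the neighbourhood makes \<open>A - B\<close> a component of its own, while
  \<open>C\<close> survives elsewhere. Every other survivor meets both \<open>A\<close> and
  \<open>B\<close> and still has a neighbour that does so too.\<close>

lemma super_vertex_cut_edge_nbrs:
  assumes n: "7 \<le> n" and tr: "A \<in> triples {1..n}" "B \<in> triples {1..n}" "C \<in> triples {1..n}"
    and AB: "A \<inter> B = {}" and C: "C \<inter> A \<noteq> {}" "C \<inter> B \<noteq> {}"
  shows "super_vertex_cut (with_proj (kneser_graph n 3)) (edge_nbrs {1..n} A B)"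
    (is "super_vertex_cut ?G ?S")
proof -
  define W where "W = triples {1..n} - ?S"
  have W: "W \<subseteq> triples {1..n}" by (simp add: W_def)
  have inW: "v \<in> W \<longleftrightarrow> v \<in> triples {1..n} \<and> (v = A \<or> v = B \<or> v \<inter> A \<noteq> {} \<and> v \<inter> B \<noteq> {})" for v
    unfolding W_def edge_nbrs_def by blast
  have mem: "A \<in> W" "B \<in> W" "C \<in> W"
    using tr C unfolding inW by simp_all
  have card: "A \<subseteq> {1..n}" "B \<subseteq> {1..n}" "card A = 3" "card B = 3"
    using tr by (simp_all add: triples_def)
  then have fin: "finite A" "finite B" by (auto intro: finite_subset)
  interpret H: sym_digraph "?G \<restriction> W" by (rule sym_digraph_induce_kneser_3[OF W])
  note adj = arcs_ends_induce_kneser_3[OF W]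
  have closed: "v = A \<or> v = B" if "A \<rightarrow>\<^sup>*\<^bsub>?G \<restriction> W\<^esub> v" for v
    using that
  proof (induction rule: H.reachable_induct)
    case (step x y)
    then have "y \<in> W" "x \<inter> y = {}" using adj by blast+
    with step.IH show ?case unfolding inW by (metis Int_commute)
  qed simp
  have not_conn: "\<not> connected (?G \<restriction> W)"
  proof
    assume "connected (?G \<restriction> W)"
    then have "strongly_connected (?G \<restriction> W)"
      by (rule H.symmetric_connected_imp_strongly_connected[OF H.sym_arcs])
    then have "A \<rightarrow>\<^sup>*\<^bsub>?G \<restriction> W\<^esub> C" using mem by (simp add: strongly_connected_def)
    then have "C = A \<or> C = B" by (rule closed)
    then show False using AB C by (metis Int_commute)
  qed
  have nbr: "\<exists>w. w \<noteq> v \<and> v \<rightarrow>\<^bsub>?G \<restriction> W\<^esub> w" if v: "v \<in> W" for v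
  proof -
    have vt: "v \<subseteq> {1..n}" "card v = 3" using v W by (auto simp: triples_def)
    have "\<exists>w \<in> W. v \<inter> w = {}"
    proof (cases "v = A \<or> v = B")
      case True
      then show ?thesis
      proof
        assume "v = A" then show ?thesis using mem(2) AB by metis
      next
        assume "v = B" then show ?thesis using mem(1) AB by (metis Int_commute)
      qed
    next
      case False
      have fin_v: "finite v" using vt(1) finite_subset by blast
      have "\<not> A \<subseteq> v" "\<not> B \<subseteq> v"
        using card_subset_eq[OF fin_v] card(3,4) vt(2) False by metis+
      then obtain x y where xy: "x \<in> A" "x \<notin> v" "y \<in> B" "y \<notin> v" by blast
      then have "x \<noteq> y" using AB by blast
      \<comment> \<open>At least three of the six points of \<open>A \<union> B\<close> lie outside
        \<open>v\<close>, so a third one \<open>z\<close> completes \<open>x\<close> and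
        \<open>y\<close> to a neighbour of \<open>v\<close> in \<open>W\<close>.\<close>
      have "card (A \<union> B) - card v \<le> card ((A \<union> B) - v)"
        using fin_v by (rule diff_card_le_card_Diff)
      moreover have "card (A \<union> B) = 6" using AB fin card(3,4) by (simp add: card_Un_disjoint)
      moreover have "card ((A \<union> B) - v) \<le> 2" if "(A \<union> B) - v \<subseteq> {x, y}"
        using card_mono[OF _ that] \<open>x \<noteq> y\<close> by simp
      ultimately have "\<not> (A \<union> B) - v \<subseteq> {x, y}" using vt(2) by linarith
      then obtain z where z: "z \<in> A \<union> B" "z \<notin> v" "z \<noteq> x" "z \<noteq> y" by blast
      have "{x, y, z} \<subseteq> {1..n}" using xy(1,3) z(1) card(1,2) by blast
      then have "{x, y, z} \<in> triples {1..n}" using \<open>x \<noteq> y\<close> z(3,4) by (simp add: triples_def)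
      moreover have "{x, y, z} \<inter> A \<noteq> {}" "{x, y, z} \<inter> B \<noteq> {}" using xy(1,3) by blast+
      ultimately have "{x, y, z} \<in> W" unfolding inW by blast
      moreover have "v \<inter> {x, y, z} = {}" using xy z by blast
      ultimately show ?thesis by blast
    qed
    then obtain w where w: "w \<in> W" "v \<inter> w = {}" by blast
    then have "w \<noteq> v" using vt(2) by auto
    with w v show ?thesis using adj by blast
  qed
  have "\<forall>K \<in> pre_digraph.sccs (?G \<restriction> W). \<not> (\<exists>v. verts K = {v})"
    by (rule H.no_trivial_scc) (rule nbr, simp only: induce_subgraph_verts)
  moreover have "?S \<subseteq> triples {1..n}" unfolding edge_nbrs_def by (rule Collect_restrict)
  moreover have "?S \<noteq> triples {1..n}" using mem(1) unfolding W_def by blast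
  ultimately show ?thesis
    using not_conn connected_kneser_3[OF n] graph_kneser_graph[of 3 n]
    unfolding super_vertex_cut_def verts_kneser_3 W_def by simp
qed

lemma super_connectivity_eqI:
  assumes "super_vertex_cut G S" "card S = k" "\<And>T. super_vertex_cut G T \<Longrightarrow> k \<le> card T"
  shows "super_connectivity G = enat k"
  unfolding super_connectivity_def
proof (rule antisym)
  show "(INF S \<in> {S. super_vertex_cut G S}. enat (card S)) \<le> enat k"
    using assms(1,2) by (auto intro: INF_lower2)
  show "enat k \<le> (INF S \<in> {S. super_vertex_cut G S}. enat (card S))"
    using assms(3) by (auto intro: INF_greatest)
qed

text \<open>The absence of one-vertex components gives every remaining vertex a remaining neighbour,
  as \<open>card_complement_ge\<close> requires.\<close>

lemma card_super_vertex_cut_ge: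
  assumes n: "7 \<le> n" and S: "super_vertex_cut (with_proj (kneser_graph n 3)) S"
  shows "2 * (((n - 3) choose 3) - 1) - ((n - 6) choose 3) \<le> card S"
proof -
  define W where "W = triples {1..n} - S"
  have W: "W \<subseteq> triples {1..n}" by (simp add: W_def)
  interpret H: sym_digraph "with_proj (kneser_graph n 3) \<restriction> W" by (rule sym_digraph_induce_kneser_3[OF W])
  have S': "S \<subseteq> triples {1..n}" "S \<noteq> triples {1..n}" "\<not> connected (with_proj (kneser_graph n 3) \<restriction> W)"
    "\<forall>C \<in> H.sccs. \<not> (\<exists>v. verts C = {v})"
    using S unfolding super_vertex_cut_def verts_kneser_3 W_def by auto
  have "\<exists>w \<in> W. v \<inter> w = {}" if "v \<in> W" for v
  proof -
    have "v \<in> verts (with_proj (kneser_graph n 3) \<restriction> W)" using that by simp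
    then obtain w where "v \<rightarrow>\<^bsub>with_proj (kneser_graph n 3) \<restriction> W\<^esub> w"
      using H.ex_dominated_if_no_trivial_scc[OF S'(4)] by blast
    then show ?thesis using arcs_ends_induce_kneser_3[OF W] by blast
  qed
  then have "2 * (((n - 3) choose 3) - 1) - ((n - 6) choose 3) \<le> card (triples {1..n} - W)"
    using S' by (intro card_complement_ge[OF n W]) (auto simp: W_def)
  moreover have "triples {1..n} - W = S" using S'(1) by (auto simp: W_def)
  ultimately show ?thesis by simp
qed

theorem theorem2p1:
  fixes n :: nat
  assumes "n \<ge> 7"
  shows "super_connectivity (with_proj (kneser_graph n 3)) =
    enat (if n \<le> 8 then 2 * (((n - 3) choose 3) - 1)
          else 2 * (((n - 3) choose 3) - 1) - ((n - 6) choose 3))"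
proof -
  \<comment> \<open>\<open>?C\<close> meets both ends of the edge \<open>?A - ?B\<close> and so
    survives the deletion; its point 7 exists as \<open>n \<ge> 7\<close>.\<close>
  let ?A = "{1,2,3::nat}" and ?B = "{4,5,6::nat}" and ?C = "{1,4,7::nat}"
  have tr: "?A \<in> triples {1..n}" "?B \<in> triples {1..n}" "?C \<in> triples {1..n}"
    using assms by (simp_all add: triples_def)
  have disj: "?A \<inter> ?B = {}" and meet: "?C \<inter> ?A \<noteq> {}" "?C \<inter> ?B \<noteq> {}" by simp_all
  have "card (edge_nbrs {1..n} ?A ?B) = 2 * (((n - 3) choose 3) - 1) - ((n - 6) choose 3)"
    using card_edge_nbrs[OF _ tr(1,2) disj] by simp
  then have "super_connectivity (with_proj (kneser_graph n 3)) =
      enat (2 * (((n - 3) choose 3) - 1) - ((n - 6) choose 3))"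
    by (rule super_connectivity_eqI[OF super_vertex_cut_edge_nbrs[OF assms tr disj meet]])
      (rule card_super_vertex_cut_ge[OF assms])
  \<comment> \<open>For \<open>n \<le> 8\<close> the last binomial vanishes because
    \<open>n - 6 < 3\<close>, so both cases of the formula agree with the bound.\<close>
  then show ?thesis by (simp add: binomial_eq_0)
qed

end
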